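(* Let $\mathring{\mathbb{D}}_2$ be an optimal minimal positive basis of $\mathbb{R}^2$ (three unit vectors, viewed as a $2\times 3$ matrix) and let $\mathring{\mathbb{D}}_1=\begin{bmatrix}1&-1\end{bmatrix}$. Let $\mathbb{D}_{3,5}=\mathrm{Diag}(\mathring{\mathbb{D}}_2,\mathring{\mathbb{D}}_1)$ be the $3\times 5$ block diagonal matrix with these blocks, regarded as the set of its five columns in $\mathbb{R}^3$. Then $\mathbb{D}_{3,5}$ is optimal over $\Omega$ (the set $\Omega$ of positive bases of size $5$ in $\mathbb{R}^3$).
   Context: The positive span $\mathrm{pspan}(S)$ of a finite set $S$ of vectors is the set of linear combinations of elements of $S$ with nonnegative coefficients. A finite set $S$ is positively independent if $d\notin\mathrm{pspan}(S\setminus\{d\})$ for all $d\in S$. A positive basis of a subspace $L$ of $\mathbb{R}^n$ is a positively independent set with positive span equal to $L$. All vectors in positive bases are assumed to be unit vectors. Sets of vectors are identified with matrices whose columns are the vectors. A positive basis of an $m$-dimensional space is minimal if it has $m+1$ elements. The cosine measure of a finite set $S$ of non-zero vectors of $\mathbb{R}^n$ is $\mathrm{cm}(S)=\min_{u\in\mathbb{R}^n,\|u\|=1}\max_{d\in S}\frac{u^\top d}{\|d\|}$. A positive basis of $\mathbb{R}^n$ of size $s$ is optimal over a non-empty set $\mathbb{P}$ of positive bases if its cosine measure is at least $\mathrm{cm}(\mathbb{D}')$ for every positive basis $\mathbb{D}'\in\mathbb{P}$ of size $s$ of $\mathbb{R}^n$. An optimal minimal positive basis of $\mathbb{R}^2$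 is a minimal positive basis of $\mathbb{R}^2$ which is optimal over the set of all positive bases of size $3$ of $\mathbb{R}^2$. For $n=3$, $s=5$, $\Omega$ is the set of positive bases of $\mathbb{R}^3$ of size $5$ that admit a partition into two subsets which are minimal positive bases of subspaces $L_1$ and $L_2$ respectively (so of sizes $\dim L_1+1$ and $\dim L_2+1$, $\dim L_i\ge 1$), where $\mathbb{R}^3=L_1\oplus L_2$ and $L_1\cap L_2=\{0\}$. *)

theory Defs
  imports "HOL-Analysis.Analysis"
begin

definition pspan :: "'a::real_vector set \<Rightarrow> 'a set" where
  "pspan S = {(\<Sum>d\<in>S. c d *\<^sub>R d) | c. \<forall>d\<in>S. 0 \<le> c d}"

definition positively_independent :: "'a::real_vector set \<Rightarrow> bool" where
  "positively_independent S \<longleftrightarrow> (\<forall>d\<in>S. d \<notin> pspan (S - {d}))"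

definition positive_basis :: "'a::euclidean_space set \<Rightarrow> 'a set \<Rightarrow> bool" where
  "positive_basis L S \<longleftrightarrow>
     subspace L \<and> finite S \<and> (\<forall>d\<in>S. norm d = 1) \<and>
     positively_independent S \<and> pspan S = L"

definition minimal_positive_basis :: "'a::euclidean_space set \<Rightarrow> 'a set \<Rightarrow> bool" where
  "minimal_positive_basis L S \<longleftrightarrow> positive_basis L S \<and> card S = dim L + 1"

text \<open>The infimum below is a minimum whenever \<open>S\<close> is finite and non-empty; see
  \<open>cosine_measure_attained\<close> and \<open>cosine_measure_le\<close>.\<close>

definition cosine_measure :: "'a::euclidean_space set \<Rightarrow> real" where
  "cosine_measure S = (INF u\<in>sphere 0 1. Max ((\<lambda>d. (u \<bullet> d) / norm d) ` S))"

text \<open>\<open>optimal_over s P D\<close>: the positive basis \<open>D\<close> of size \<open>s\<close> of the whole space is optimal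
  over the non-empty family \<open>P\<close>.\<close>

definition optimal_over :: "nat \<Rightarrow> 'a::euclidean_space set set \<Rightarrow> 'a set \<Rightarrow> bool" where
  "optimal_over s P D \<longleftrightarrow>
     P \<noteq> {} \<and> positive_basis UNIV D \<and> card D = s \<and>
     (\<forall>D'\<in>P. positive_basis UNIV D' \<and> card D' = s \<longrightarrow> cosine_measure D' \<le> cosine_measure D)"

definition optimal_minimal_positive_basis_R2 :: "(real^2) set \<Rightarrow> bool" where
  "optimal_minimal_positive_basis_R2 D \<longleftrightarrow>
     minimal_positive_basis UNIV D \<and>
     optimal_over 3 {D'. positive_basis UNIV D' \<and> card D' = 3} D"

definition Omega :: "(real^3) set set" where
  "Omega = {D. positive_basis UNIV D \<and> card D = 5 \<and>
     (\<exists>D1 D2 L1 L2. D = D1 \<union> D2 \<and> D1 \<inter> D2 = {} \<and>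
        subspace L1 \<and> subspace L2 \<and> dim L1 \<ge> 1 \<and> dim L2 \<ge> 1 \<and>
        {x + y | x y. x \<in> L1 \<and> y \<in> L2} = UNIV \<and> L1 \<inter> L2 = {0} \<and>
        minimal_positive_basis L1 D1 \<and> minimal_positive_basis L2 D2)}"

text \<open>The set of columns of the block diagonal matrix whose diagonal blocks have column sets
  \<open>A\<close> (two rows) and \<open>B\<close> (one row).\<close>

definition Diag :: "(real^2) set \<Rightarrow> (real^1) set \<Rightarrow> (real^3) set" where
  "Diag A B = (\<lambda>a. vector [a $ 1, a $ 2, 0]) ` A \<union> (\<lambda>b. vector [0, 0, b $ 1]) ` B"

lemma continuous_on_Max_inner:
  fixes S :: "'a::euclidean_space set"
  assumes "finite S" "S \<noteq> {}"
  shows "continuous_on T (\<lambda>u. Max ((\<lambda>d. (u \<bullet> d) / norm d) ` S))"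
  using assms
proof (induction S rule: finite_ne_induct)
  case (singleton x)
  show ?case by (simp add: divide_inverse) (intro continuous_intros)
next
  case (insert x F)
  have "(\<lambda>u. Max ((\<lambda>d. (u \<bullet> d) / norm d) ` insert x F)) =
        (\<lambda>u. max (u \<bullet> x * inverse (norm x)) (Max ((\<lambda>d. (u \<bullet> d) / norm d) ` F)))"
    using insert.hyps by (simp add: divide_inverse)
  moreover have "continuous_on T \<dots>"
    by (intro continuous_on_max continuous_intros insert.IH)
  ultimately show ?case by (simp only:)
qed

lemma cosine_measure_min:
  fixes S :: "'a::euclidean_space set"
  assumes "finite S" "S \<noteq> {}"
  shows cosine_measure_attained:
      "\<exists>u\<in>sphere 0 1. cosine_measure S = Max ((\<lambda>d. (u \<bullet> d) / norm d) ` S)"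
    and cosine_measure_le:
      "\<And>u. norm u = 1 \<Longrightarrow> cosine_measure S \<le> Max ((\<lambda>d. (u \<bullet> d) / norm d) ` S)"
proof -
  let ?f = "\<lambda>u. Max ((\<lambda>d. (u \<bullet> d) / norm d) ` S)"
  have "sphere (0::'a) 1 \<noteq> {}" by simp
  then obtain u where u: "u \<in> sphere 0 1" "\<forall>v\<in>sphere 0 1. ?f u \<le> ?f v"
    using continuous_attains_inf[OF compact_sphere _ continuous_on_Max_inner[OF assms]] by blast
  have eq: "cosine_measure S = ?f u"
    unfolding cosine_measure_def using u by (intro cInf_eq_minimum) auto
  show "\<exists>u\<in>sphere 0 1. cosine_measure S = ?f u" using u eq by blast
  show "\<And>u. norm u = 1 \<Longrightarrow> cosine_measure S \<le> ?f u" using u eq by simp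
qed

end

theory Submission
  imports Defs
begin

text \<open>Put \<open>r = 1 / \<surd>5\<close>. Every member of \<open>\<Omega>\<close> has cosine measure at most \<open>r\<close>, and the
  block diagonal basis reaches \<open>r\<close>.

  Upper bound. Dimensions add up to three, so a member of \<open>\<Omega>\<close> consists of three unit vectors
  that positively span a plane \<open>L\<close> and a pair \<open>\<plusminus>w\<close> with \<open>w \<notin> L\<close>. Two of the three plane
  vectors have inner product at most \<open>-1/2\<close>, and the bisector \<open>v\<close> of these two satisfies
  \<open>v \<bullet> d \<le> 1/2\<close> for all three (\<open>minimal_positive_basis_plane_direction\<close>). Moving the point
  \<open>2 r v\<close> orthogonally to \<open>L\<close> does not change its inner products with the plane vectors, all at
  most \<open>r\<close>. It is moved until its inner product with \<open>w\<close> is \<open>r\<close> or \<open>-r\<close>, and of these two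
  positions the farther one is taken; the displacement then has length at least \<open>r\<close>
  (\<open>orthogonal_lift_to_slab\<close>). The resulting vector has norm at least \<open>\<surd>(4 r\<^sup>2 + r\<^sup>2) = 1\<close> and inner
  product at most \<open>r\<close> with all five vectors.

  Lower bound. The three unit vectors at mutual angles of 120 degrees have cosine measure at
  least \<open>1/2\<close>, hence so does every optimal minimal positive basis of the plane. Split a unit
  vector of space into its plane part \<open>p\<close> and its height \<open>t\<close>: some element of the block
  diagonal basis has inner product at least \<open>max (\<parallel>p\<parallel> / 2) \<bar>t\<bar>\<close> with it, which is at least \<open>r\<close>
  because \<open>\<parallel>p\<parallel>\<^sup>2 + t\<^sup>2 = 1\<close>.\<close>

section \<open>Positive spans and positive bases\<close>

lemma pspanI:
  assumes "\<And>d. d \<in> S \<Longrightarrow> 0 \<le> c d" "x = (\<Sum>d\<in>S. c d *\<^sub>R d)"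
  shows "x \<in> pspan S"
  using assms unfolding pspan_def by blast

lemma pspanE:
  assumes "x \<in> pspan S"
  obtains c where "\<forall>d\<in>S. 0 \<le> c d" "x = (\<Sum>d\<in>S. c d *\<^sub>R d)"
  using assms unfolding pspan_def by blast

lemma subset_pspan:
  assumes "finite S"
  shows "S \<subseteq> pspan S"
proof
  fix x assume "x \<in> S"
  then show "x \<in> pspan S"
    using assms by (intro pspanI[where c = "\<lambda>d. if d = x then 1 else 0"])
      (auto simp: if_distrib[of "\<lambda>k. k *\<^sub>R _"] cong: if_cong)
qed

lemma pspan_doubletonE:
  assumes "x \<in> pspan {b, c}" "b \<noteq> c"
  obtains \<beta> \<gamma> where "0 \<le> \<beta>" "0 \<le> \<gamma>" "x = \<beta> *\<^sub>R b + \<gamma> *\<^sub>R c"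
proof -
  obtain k where "\<forall>d\<in>{b, c}. 0 \<le> k d" "x = (\<Sum>d\<in>{b, c}. k d *\<^sub>R d)"
    using assms(1) by (rule pspanE)
  then show thesis using that[of "k b" "k c"] assms(2) by simp
qed

lemma pspan_Un_disjoint:
  assumes "finite A" "finite B" "A \<inter> B = {}"
  shows "pspan (A \<union> B) = {x + y | x y. x \<in> pspan A \<and> y \<in> pspan B}"
proof (intro equalityI subsetI)
  fix z assume "z \<in> pspan (A \<union> B)"
  then obtain c where c: "\<And>d. d \<in> A \<union> B \<Longrightarrow> 0 \<le> c d" "z = (\<Sum>d\<in>A \<union> B. c d *\<^sub>R d)"
    by (blast elim: pspanE)
  have "z = (\<Sum>d\<in>A. c d *\<^sub>R d) + (\<Sum>d\<in>B. c d *\<^sub>R d)"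
    using c(2) assms by (simp add: sum.union_disjoint)
  moreover have "(\<Sum>d\<in>A. c d *\<^sub>R d) \<in> pspan A" "(\<Sum>d\<in>B. c d *\<^sub>R d) \<in> pspan B"
    using c(1) by (auto intro!: pspanI[where c = c])
  ultimately show "z \<in> {x + y | x y. x \<in> pspan A \<and> y \<in> pspan B}" by blast
next
  fix z assume "z \<in> {x + y | x y. x \<in> pspan A \<and> y \<in> pspan B}"
  then obtain x y where xy: "z = x + y" "x \<in> pspan A" "y \<in> pspan B" by blast
  obtain a where a: "\<And>d. d \<in> A \<Longrightarrow> 0 \<le> a d" "x = (\<Sum>d\<in>A. a d *\<^sub>R d)"
    using xy(2) by (blast elim: pspanE)
  obtain b where b: "\<And>d. d \<in> B \<Longrightarrow> 0 \<le> b d" "y = (\<Sum>d\<in>B. b d *\<^sub>R d)"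
    using xy(3) by (blast elim: pspanE)
  let ?c = "\<lambda>d. if d \<in> A then a d else b d"
  have "(\<Sum>d\<in>B. ?c d *\<^sub>R d) = (\<Sum>d\<in>B. b d *\<^sub>R d)"
    using assms(3) by (intro sum.cong) auto
  then have "z = (\<Sum>d\<in>A \<union> B. ?c d *\<^sub>R d)"
    using assms xy(1) a(2) b(2) by (simp add: sum.union_disjoint)
  then show "z \<in> pspan (A \<union> B)"
    using a(1) b(1) by (intro pspanI[where c = ?c]) auto
qed

lemma pspan_linear_image:
  fixes f :: "'a::real_vector \<Rightarrow> 'b::real_vector"
  assumes "linear f" "inj f"
  shows "pspan (f ` S) = f ` pspan S"
proof -
  have inj: "inj_on f S" using assms(2) by (rule inj_on_subset) simp
  have eq: "(\<Sum>d\<in>f ` S. c d *\<^sub>R d) = f (\<Sum>d\<in>S. c (f d) *\<^sub>R d)" for c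
    by (simp add: sum.reindex[OF inj] linear_sum[OF assms(1)] linear_scale[OF assms(1)])
  show ?thesis
  proof (intro equalityI subsetI)
    fix z assume "z \<in> pspan (f ` S)"
    then obtain c where c: "\<And>d. d \<in> f ` S \<Longrightarrow> 0 \<le> c d" "z = (\<Sum>d\<in>f ` S. c d *\<^sub>R d)"
      by (blast elim: pspanE)
    have "(\<Sum>d\<in>S. c (f d) *\<^sub>R d) \<in> pspan S"
      using c(1) by (auto intro!: pspanI[where c = "\<lambda>d. c (f d)"])
    then show "z \<in> f ` pspan S" using c(2) eq by blast
  next
    fix z assume "z \<in> f ` pspan S"
    then obtain x where x: "z = f x" "x \<in> pspan S" by blast
    obtain c where c: "\<And>d. d \<in> S \<Longrightarrow> 0 \<le> c d" "x = (\<Sum>d\<in>S. c d *\<^sub>R d)"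
      using x(2) by (blast elim: pspanE)
    have "z = (\<Sum>d\<in>f ` S. c (inv f d) *\<^sub>R d)"
      unfolding eq using x(1) c(2) assms(2) by simp
    then show "z \<in> pspan (f ` S)"
      using c(1) assms(2) by (intro pspanI[where c = "\<lambda>d. c (inv f d)"]) auto
  qed
qed

lemma minimal_positive_basis_isometric_image:
  fixes f :: "'a::euclidean_space \<Rightarrow> 'b::euclidean_space"
  assumes f: "linear f" "\<And>x. norm (f x) = norm x"
    and S: "minimal_positive_basis L S"
  shows "minimal_positive_basis (f ` L) (f ` S)"
proof -
  have inj: "inj f"
    using f by (metis linear_injective_0 norm_eq_zero)
  have L: "subspace L" "finite S" "\<forall>d\<in>S. norm d = 1" "positively_independent S" "pspan S = L"
    "card S = dim L + 1"
    using S by (auto simp: minimal_positive_basis_def positive_basis_def)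
  have "positively_independent (f ` S)"
    unfolding positively_independent_def
  proof
    fix d assume "d \<in> f ` S"
    then obtain x where x: "x \<in> S" "d = f x" by blast
    have "f ` S - {d} = f ` (S - {x})"
      using x(2) inj by (auto simp: inj_eq)
    then show "d \<notin> pspan (f ` S - {d})"
      using x L(4) inj by (auto simp: pspan_linear_image[OF f(1) inj] positively_independent_def inj_eq)
  qed
  moreover have "dim (f ` L) = dim L"
    by (rule dim_image_eq[OF f(1)]) (use inj in \<open>auto intro: inj_on_subset\<close>)
  moreover have "card (f ` S) = card S"
    by (rule card_image) (use inj in \<open>auto intro: inj_on_subset\<close>)
  ultimately show ?thesis
    unfolding minimal_positive_basis_def positive_basis_def
    using L f pspan_linear_image[OF f(1) inj] by (auto simp: linear_subspace_image)
qed

text \<open>Write \<open>d = p + q\<close> with \<open>p\<close> generated by the rest of \<open>A\<close> and \<open>q\<close> by \<open>B\<close>. Then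
  \<open>q = d - p\<close> lies in both subspaces, so \<open>q = 0\<close> and \<open>d\<close> already depends on the rest of \<open>A\<close>.\<close>

lemma positively_independent_Un_left:
  assumes L: "subspace L1" "subspace L2" "L1 \<inter> L2 = {0}"
    and A: "positive_basis L1 A" and B: "positive_basis L2 B" and d: "d \<in> A"
  shows "d \<notin> pspan ((A - {d}) \<union> B)"
proof
  assume "d \<in> pspan ((A - {d}) \<union> B)"
  have fin: "finite A" "finite B" and sp: "pspan A = L1" "pspan B = L2"
    and ind: "positively_independent A" and un: "\<forall>a\<in>A. norm a = 1"
    using A B by (auto simp: positive_basis_def)
  have sub: "A \<subseteq> L1" "B \<subseteq> L2" using subset_pspan fin sp by auto
  then have "A \<inter> B \<subseteq> {0}" using L(3) by blast
  then have "(A - {d}) \<inter> B = {}" using un by fastforce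
  then obtain p q where pq: "d = p + q" "p \<in> pspan (A - {d})" "q \<in> L2"
    using \<open>d \<in> pspan ((A - {d}) \<union> B)\<close> fin sp by (auto simp: pspan_Un_disjoint)
  obtain c where c: "p = (\<Sum>x\<in>A - {d}. c x *\<^sub>R x)"
    using pq(2) by (blast elim: pspanE)
  have "p \<in> L1" unfolding c using L(1) sub(1)
    by (intro subspace_sum subspace_scale) auto
  then have "q \<in> L1" using pq(1) d sub(1) L(1)
    by (metis add_diff_cancel_left' subsetD subspace_diff)
  then have "d = p" using pq L(3) by auto
  then show False using pq(2) ind d by (auto simp: positively_independent_def)
qed

lemma positive_basis_Un:
  assumes L: "subspace L1" "subspace L2" "L1 \<inter> L2 = {0}"
    and sum: "{x + y | x y. x \<in> L1 \<and> y \<in> L2} = UNIV"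
    and A: "positive_basis L1 A" and B: "positive_basis L2 B"
  shows "A \<inter> B = {}" "positive_basis UNIV (A \<union> B)"
proof -
  have fin: "finite A" "finite B" and sp: "pspan A = L1" "pspan B = L2"
    and un: "\<forall>a\<in>A. norm a = 1" "\<forall>b\<in>B. norm b = 1"
    using A B by (auto simp: positive_basis_def)
  have "A \<inter> B \<subseteq> {0}" using subset_pspan[OF fin(1)] subset_pspan[OF fin(2)] sp L(3) by blast
  then show disj: "A \<inter> B = {}" using un by fastforce
  have "positively_independent (A \<union> B)"
    unfolding positively_independent_def
  proof
    fix d assume "d \<in> A \<union> B"
    then consider "d \<in> A" "d \<notin> B" | "d \<in> B" "d \<notin> A" using disj by blast
    then show "d \<notin> pspan (A \<union> B - {d})"
    proof cases
      case 1
      then have "A \<union> B - {d} = (A - {d}) \<union> B" by blast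
      then show ?thesis using positively_independent_Un_left[OF L A B 1(1)] by simp
    next
      case 2
      then have "A \<union> B - {d} = (B - {d}) \<union> A" by blast
      moreover have "L2 \<inter> L1 = {0}" using L(3) by blast
      ultimately show ?thesis
        using positively_independent_Un_left[OF L(2,1) _ B A 2(1)] by simp
    qed
  qed
  then show "positive_basis UNIV (A \<union> B)"
    using fin un sp sum pspan_Un_disjoint[OF fin disj] by (auto simp: positive_basis_def)
qed

text \<open>Since \<open>-\<Sum>S\<close> is a nonnegative combination of \<open>S\<close>, adding \<open>\<Sum>S\<close> to that combination
  makes every coefficient at least one.\<close>

lemma positive_basis_positive_relation:
  assumes "positive_basis L S"
  obtains c where "\<forall>d\<in>S. 0 < c d" "(\<Sum>d\<in>S. c d *\<^sub>R d) = 0"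
proof -
  have S: "subspace L" "finite S" "pspan S = L"
    using assms by (auto simp: positive_basis_def)
  have "- (\<Sum>S) \<in> pspan S"
    using S subset_pspan[OF S(2)] by (auto intro!: subspace_neg subspace_sum)
  then obtain c where c: "\<forall>d\<in>S. 0 \<le> c d" "- (\<Sum>S) = (\<Sum>d\<in>S. c d *\<^sub>R d)"
    by (metis pspanE)
  show thesis
  proof
    show "\<forall>d\<in>S. 0 < c d + 1" using c(1) by (simp add: add_nonneg_pos)
    show "(\<Sum>d\<in>S. (c d + 1) *\<^sub>R d) = 0"
      using c(2) by (simp add: scaleR_add_left sum.distrib flip: c(2))
  qed
qed

lemma minimal_positive_basis_line:
  assumes "minimal_positive_basis L D" "dim L = 1"
  obtains w where "norm w = 1" "D = {w, -w}" "w \<in> L"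
proof -
  have D: "positive_basis L D" "card D = 2" "\<forall>d\<in>D. norm d = 1" "finite D" "pspan D = L"
    using assms by (auto simp: minimal_positive_basis_def positive_basis_def)
  obtain a b where ab: "D = {a, b}" "a \<noteq> b" using D(2) by (auto simp: card_2_iff)
  obtain c where c: "\<forall>d\<in>D. 0 < c d" "(\<Sum>d\<in>D. c d *\<^sub>R d) = 0"
    using positive_basis_positive_relation[OF D(1)] by metis
  have rel: "c a *\<^sub>R a = - (c b *\<^sub>R b)"
    using c(2) ab by (simp add: eq_neg_iff_add_eq_0)
  then have "norm (c a *\<^sub>R a) = norm (c b *\<^sub>R b)" by simp
  moreover have pos: "0 < c a" "0 < c b" and "norm a = 1" "norm b = 1" using c(1) ab D(3) by auto
  ultimately have "c a = c b" by simp
  then have "c a *\<^sub>R a = c a *\<^sub>R (- b)" using rel by simp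
  then have "a = - b" using pos(1) by (metis less_irrefl scaleR_cancel_left)
  then have "b = - a" by simp
  moreover have "a \<in> L" using subset_pspan[OF D(4)] D(5) ab by blast
  ultimately show thesis using that[of a] ab D(3) by simp
qed

section \<open>The upper bound\<close>

text \<open>The direction is the bisector \<open>(a + b) / \<parallel>a + b\<parallel>\<close>, whose inner product with \<open>a\<close> and with \<open>b\<close>
  is \<open>\<parallel>a + b\<parallel> / 2\<close>, and \<open>\<parallel>a + b\<parallel>\<^sup>2 = 2 (1 + a \<bullet> b) \<le> 1\<close>; the third vector lies in the cone opposite to \<open>a\<close> and \<open>b\<close>.\<close>

lemma bisector_of_wide_pair:
  fixes a b c :: "'a::real_inner"
  assumes unit: "norm a = 1" "norm b = 1" "norm c = 1"
    and ne: "c \<noteq> a" "c \<noteq> b"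
    and pos: "0 < x" "0 < y" "0 < z" and rel: "x *\<^sub>R a + y *\<^sub>R b + z *\<^sub>R c = 0"
    and wide: "a \<bullet> b \<le> -1/2"
  obtains v where "norm v = 1" "v \<in> span {a, b}" "v \<bullet> a \<le> 1/2" "v \<bullet> b \<le> 1/2" "v \<bullet> c \<le> 1/2"
proof -
  have aa: "a \<bullet> a = 1" "b \<bullet> b = 1" using unit by (auto simp: norm_eq_1)
  have zc: "z *\<^sub>R c = - (x *\<^sub>R a + y *\<^sub>R b)"
    using rel by (simp add: eq_neg_iff_add_eq_0 algebra_simps)
  \<comment> \<open>If \<open>b = -a\<close>, the relation makes \<open>c\<close> a unit multiple of \<open>a\<close>, hence equal to \<open>a\<close> or \<open>b\<close>.\<close>
  have "a + b \<noteq> 0"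
  proof
    assume "a + b = 0"
    then have b: "b = - a" by (simp add: eq_neg_iff_add_eq_0 add.commute)
    have zc': "z *\<^sub>R c = (y - x) *\<^sub>R a" using zc b by (simp add: algebra_simps)
    then have "norm (z *\<^sub>R c) = norm ((y - x) *\<^sub>R a)" by simp
    then have "z = \<bar>y - x\<bar>" using unit pos by simp
    then consider "y - x = z" | "y - x = - z" by linarith
    then show False
    proof cases
      case 1 then show False using zc' pos ne by auto
    next
      case 2
      then have "z *\<^sub>R c = z *\<^sub>R b" using zc' b by simp
      then show False using pos ne by auto
    qed
  qed
  define N where "N = norm (a + b)"
  have N0: "N > 0" using \<open>a + b \<noteq> 0\<close> by (simp add: N_def)
  have N2: "N\<^sup>2 = 2 * (1 + a \<bullet> b)"
    unfolding N_def power2_norm_eq_inner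
    by (simp add: inner_add_left inner_add_right aa inner_commute[of b a])
  have "N\<^sup>2 \<le> 1\<^sup>2" using N2 wide by simp
  then have "N \<le> 1" by (rule power2_le_imp_le) simp
  define v where "v = (1 / N) *\<^sub>R (a + b)"
  have "v \<bullet> a = (1 + a \<bullet> b) / N" "v \<bullet> b = (1 + a \<bullet> b) / N"
    by (simp_all add: v_def inner_add_left aa inner_commute[of b a])
  moreover have "1 + a \<bullet> b = N * N / 2" using N2 by (simp add: power2_eq_square)
  ultimately have va: "v \<bullet> a = N / 2" "v \<bullet> b = N / 2" using N0 by simp_all
  have "z * (v \<bullet> c) = v \<bullet> (z *\<^sub>R c)" by simp
  also have "\<dots> = - ((x + y) * (N / 2))"
    unfolding zc by (simp only: inner_minus_right inner_add_right inner_scaleR_right va) (simp add: algebra_simps)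
  also have "\<dots> \<le> 0" using pos N0 by simp
  finally have "v \<bullet> c \<le> 0" using pos by (simp add: mult_le_0_iff)
  moreover have "norm v = 1" using N0 by (simp add: v_def N_def[symmetric])
  moreover have "v \<in> span {a, b}"
    unfolding v_def by (intro span_scale span_add span_base) auto
  ultimately show thesis using that[of v] va \<open>N \<le> 1\<close> by simp
qed

text \<open>Pair the positive relation \<open>x a + y b + z c = 0\<close> with \<open>a + b + c\<close>. If all mutual inner
  products exceeded \<open>-1/2\<close>, the coefficients \<open>1 + a \<bullet> b + a \<bullet> c\<close> of \<open>x\<close>, and likewise those of
  \<open>y\<close> and \<open>z\<close>, would be positive.\<close>

lemma wide_pair_exists:
  fixes a b c :: "'a::real_inner"
  assumes unit: "norm a = 1" "norm b = 1" "norm c = 1"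
    and pos: "0 < x" "0 < y" "0 < z" and rel: "x *\<^sub>R a + y *\<^sub>R b + z *\<^sub>R c = 0"
  shows "a \<bullet> b \<le> -1/2 \<or> b \<bullet> c \<le> -1/2 \<or> c \<bullet> a \<le> -1/2"
proof (rule ccontr)
  assume "\<not> ?thesis"
  then have g: "a \<bullet> b > -1/2" "b \<bullet> c > -1/2" "c \<bullet> a > -1/2" by auto
  have aa: "a \<bullet> a = 1" "b \<bullet> b = 1" "c \<bullet> c = 1" using unit by (auto simp: norm_eq_1)
  have "0 = (x *\<^sub>R a + y *\<^sub>R b + z *\<^sub>R c) \<bullet> (a + b + c)" using rel by simp
  also have "\<dots> = x * (1 + a \<bullet> b + c \<bullet> a) + y * (1 + a \<bullet> b + b \<bullet> c) + z * (1 + b \<bullet> c + c \<bullet> a)"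
    by (simp add: inner_add_left inner_add_right aa inner_commute[of b a] inner_commute[of c b]
        inner_commute[of a c] algebra_simps)
  also have "\<dots> > 0"
  proof -
    have "0 < 1 + a \<bullet> b + c \<bullet> a" "0 < 1 + a \<bullet> b + b \<bullet> c" "0 < 1 + b \<bullet> c + c \<bullet> a"
      using g by linarith+
    then show ?thesis using pos by (simp add: add_pos_pos)
  qed
  finally show False by simp
qed

lemma minimal_positive_basis_plane_direction:
  assumes "minimal_positive_basis L D" "dim L = 2"
  obtains v where "v \<in> L" "norm v = 1" "\<And>d. d \<in> D \<Longrightarrow> v \<bullet> d \<le> 1/2"
proof -
  have D: "positive_basis L D" "card D = 3" "\<forall>d\<in>D. norm d = 1" "subspace L" "finite D" "pspan D = L"
    using assms by (auto simp: minimal_positive_basis_def positive_basis_def)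
  obtain a b c where abc: "D = {a, b, c}" "a \<noteq> b" "b \<noteq> c" "a \<noteq> c"
    using D(2) by (auto simp: card_3_iff)
  obtain k where k: "\<forall>d\<in>D. 0 < k d" "(\<Sum>d\<in>D. k d *\<^sub>R d) = 0"
    using positive_basis_positive_relation[OF D(1)] by metis
  have unit: "norm a = 1" "norm b = 1" "norm c = 1" using abc D(3) by auto
  have pos: "0 < k a" "0 < k b" "0 < k c" using abc k(1) by auto
  have rel: "k a *\<^sub>R a + k b *\<^sub>R b + k c *\<^sub>R c = 0"
    using k(2) abc by (simp add: add.assoc)
  then have rel': "k b *\<^sub>R b + k c *\<^sub>R c + k a *\<^sub>R a = 0" "k c *\<^sub>R c + k a *\<^sub>R a + k b *\<^sub>R b = 0"
    by (simp_all add: algebra_simps)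
  have "D \<subseteq> L" using subset_pspan D by blast
  then have span: "span D \<subseteq> L" using D(4) by (simp add: span_minimal)
  have sp: "span {a, b} \<subseteq> span D" "span {b, c} \<subseteq> span D" "span {c, a} \<subseteq> span D"
    using abc by (auto intro!: span_mono)
  have "\<exists>v. norm v = 1 \<and> v \<in> span D \<and> v \<bullet> a \<le> 1/2 \<and> v \<bullet> b \<le> 1/2 \<and> v \<bullet> c \<le> 1/2"
    using wide_pair_exists[OF unit pos rel]
  proof (elim disjE)
    assume "a \<bullet> b \<le> -1/2"
    from bisector_of_wide_pair[OF unit _ _ pos rel this] abc sp show ?thesis by (metis subsetD)
  next
    assume "b \<bullet> c \<le> -1/2"
    from bisector_of_wide_pair[OF unit(2,3,1) _ _ pos(2,3,1) rel'(1) this] abc sp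
    show ?thesis by (metis subsetD)
  next
    assume "c \<bullet> a \<le> -1/2"
    from bisector_of_wide_pair[OF unit(3,1,2) _ _ pos(3,1,2) rel'(2) this] abc sp
    show ?thesis by (metis subsetD)
  qed
  then show thesis using that span abc by blast
qed

text \<open>Let \<open>n\<close> be the component of \<open>w\<close> orthogonal to \<open>L\<close> and look at the line \<open>x + \<beta> n\<close>. It meets
  both faces of the slab \<open>\<bar>u \<bullet> w\<bar> \<le> r\<close>; the face on which
  \<open>u \<bullet> w\<close> has the sign opposite to \<open>x \<bullet> w\<close> is reached after a displacement of length \<open>(r + \<bar>x \<bullet> w\<bar>) / \<parallel>n\<parallel> \<ge> r\<close>, because \<open>\<parallel>n\<parallel> \<le> 1\<close>.\<close>

lemma orthogonal_lift_to_slab: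
  fixes L :: "'a::euclidean_space set"
  assumes L: "subspace L" "x \<in> L" and w: "norm w = 1" "w \<notin> L" and r: "0 \<le> r"
  obtains u where "\<And>d. d \<in> L \<Longrightarrow> u \<bullet> d = x \<bullet> d" "\<bar>u \<bullet> w\<bar> = r" "(norm x)\<^sup>2 + r\<^sup>2 \<le> (norm u)\<^sup>2"
proof -
  obtain y n where yn: "y \<in> span L" "\<And>d. d \<in> span L \<Longrightarrow> orthogonal n d" "w = y + n"
    using orthogonal_subspace_decomp_exists[of L w] by blast
  have y: "y \<in> L" and orth: "\<And>d. d \<in> L \<Longrightarrow> n \<bullet> d = 0"
    using yn L(1) by (auto simp: span_eq_iff[THEN iffD2] orthogonal_def)
  have n0: "n \<noteq> 0" using w(2) y yn(3) by auto
  have nw: "n \<bullet> w = n \<bullet> n" using orth[OF y] yn(3) by (simp add: inner_add_right)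
  have "n \<bullet> n \<le> 1"
  proof -
    have "w \<bullet> w = 1" using w by (simp add: norm_eq_1)
    then have "y \<bullet> y + n \<bullet> n = 1"
      using orth[OF y] yn(3) by (simp add: inner_add_left inner_add_right inner_commute)
    then show ?thesis using inner_ge_zero[of y] by linarith
  qed
  have nn: "0 < n \<bullet> n" using n0 by simp
  define s where "s = (if x \<bullet> w \<le> 0 then r else - r)"
  define \<beta> where "\<beta> = (s - x \<bullet> w) / (n \<bullet> n)"
  have s: "\<bar>s\<bar> = r" "\<bar>s - x \<bullet> w\<bar> \<ge> r" using r by (auto simp: s_def)
  define u where "u = x + \<beta> *\<^sub>R n"
  have "u \<bullet> w = s" using nn by (simp add: u_def inner_add_left nw \<beta>_def)
  moreover have "u \<bullet> d = x \<bullet> d" if "d \<in> L" for d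
    using orth[OF that] by (simp add: u_def inner_add_left)
  moreover have "(norm x)\<^sup>2 + r\<^sup>2 \<le> (norm u)\<^sup>2"
  proof -
    have "(norm u)\<^sup>2 = (norm x)\<^sup>2 + \<beta>\<^sup>2 * (n \<bullet> n)"
      unfolding u_def power2_norm_eq_inner using orth[OF L(2)]
      by (simp add: inner_add_left inner_add_right inner_commute power2_eq_square)
    moreover have "\<beta>\<^sup>2 * (n \<bullet> n) = (s - x \<bullet> w)\<^sup>2 / (n \<bullet> n)"
      using nn by (simp add: \<beta>_def power2_eq_square)
    moreover have "r\<^sup>2 \<le> (s - x \<bullet> w)\<^sup>2" using s(2) r by (metis abs_ge_zero abs_of_nonneg power2_abs power_mono)
    moreover have "(s - x \<bullet> w)\<^sup>2 \<le> (s - x \<bullet> w)\<^sup>2 / (n \<bullet> n)"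
      using nn \<open>n \<bullet> n \<le> 1\<close> by (simp add: le_divide_eq mult_left_le)
    ultimately show ?thesis by linarith
  qed
  ultimately show thesis using that s(1) by blast
qed

lemma cosine_measure_le_of_long_vector:
  fixes S :: "'a::euclidean_space set"
  assumes S: "finite S" "S \<noteq> {}" "\<And>d. d \<in> S \<Longrightarrow> norm d = 1"
    and u: "1 \<le> norm u" "\<And>d. d \<in> S \<Longrightarrow> u \<bullet> d \<le> r" and r: "0 \<le> r"
  shows "cosine_measure S \<le> r"
proof -
  define v where "v = (1 / norm u) *\<^sub>R u"
  have u0: "norm u > 0" using u(1) by linarith
  then have v: "norm v = 1" by (simp add: v_def)
  have "(v \<bullet> d) / norm d \<le> r" if "d \<in> S" for d
  proof -
    have "u \<bullet> d \<le> r * 1" using u(2)[OF that] by simp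
    also have "\<dots> \<le> r * norm u" using r u(1) by (intro mult_left_mono) auto
    finally show ?thesis using S(3)[OF that] u0 by (simp add: v_def field_simps)
  qed
  then have "Max ((\<lambda>d. (v \<bullet> d) / norm d) ` S) \<le> r" using S by simp
  then show ?thesis using cosine_measure_le[OF S(1,2) v] by linarith
qed

lemma cosine_measure_plane_line_le:
  fixes L1 L2 :: "'a::euclidean_space set"
  assumes "minimal_positive_basis L1 D1" "dim L1 = 1"
    and "minimal_positive_basis L2 D2" "dim L2 = 2" and int: "L1 \<inter> L2 = {0}"
  shows "cosine_measure (D1 \<union> D2) \<le> 1 / sqrt 5"
proof -
  obtain w where w: "norm w = 1" "D1 = {w, -w}" "w \<in> L1"
    using minimal_positive_basis_line[OF assms(1,2)] by blast
  obtain v where v: "v \<in> L2" "norm v = 1" "\<And>d. d \<in> D2 \<Longrightarrow> v \<bullet> d \<le> 1/2"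
    using minimal_positive_basis_plane_direction[OF assms(3,4)] by blast
  have D2: "subspace L2" "finite D2" "\<forall>d\<in>D2. norm d = 1" "D2 \<subseteq> L2"
    using assms(3) subset_pspan by (auto simp: minimal_positive_basis_def positive_basis_def)
  define r where "r = 1 / sqrt 5"
  have r: "0 < r" "r\<^sup>2 = 1 / 5" by (auto simp: r_def power_divide)
  have "w \<notin> L2" using int w(1,3) by (metis IntI norm_zero singletonD zero_neq_one)
  obtain u where u: "\<And>d. d \<in> L2 \<Longrightarrow> u \<bullet> d = ((2 * r) *\<^sub>R v) \<bullet> d" "\<bar>u \<bullet> w\<bar> = r"
      "(norm ((2 * r) *\<^sub>R v))\<^sup>2 + r\<^sup>2 \<le> (norm u)\<^sup>2"
    using orthogonal_lift_to_slab[OF D2(1) subspace_scale[OF D2(1) v(1)] w(1) \<open>w \<notin> L2\<close> less_imp_le[OF r(1)]]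
    by blast
  have "1 \<le> (norm u)\<^sup>2" using u(3) v(2) r by (simp add: power_mult_distrib)
  then have "1 \<le> norm u" by (metis norm_ge_zero one_power2 power2_le_imp_le)
  moreover have "u \<bullet> d \<le> r" if "d \<in> D1 \<union> D2" for d
  proof (cases "d \<in> D1")
    case True then show ?thesis using u(2) w(2) by auto
  next
    case False
    then have d: "d \<in> D2" using that by blast
    have "u \<bullet> d = r * (2 * (v \<bullet> d))" using u(1) d D2(4) by auto
    also have "\<dots> \<le> r * 1" using v(3)[OF d] r by (intro mult_left_mono) auto
    finally show ?thesis by simp
  qed
  ultimately have "cosine_measure (D1 \<union> D2) \<le> r"
    using w D2 r by (intro cosine_measure_le_of_long_vector[of _ u]) auto
  then show ?thesis by (simp add: r_def)
qed

lemma cosine_measure_Omega_le: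
  assumes "D \<in> Omega"
  shows "cosine_measure D \<le> 1 / sqrt 5"
proof -
  obtain D1 D2 L1 L2 where D: "D = D1 \<union> D2" "subspace L1" "subspace L2" "dim L1 \<ge> 1" "dim L2 \<ge> 1"
      "{x + y | x y. x \<in> L1 \<and> y \<in> L2} = UNIV" "L1 \<inter> L2 = {0}"
      "minimal_positive_basis L1 D1" "minimal_positive_basis L2 D2"
    using assms unfolding Omega_def by blast
  have "dim L1 + dim L2 = 3"
    using dim_sums_Int[OF D(2,3)] D(6,7) by simp
  then consider "dim L1 = 1" "dim L2 = 2" | "dim L2 = 1" "dim L1 = 2" using D(4,5) by linarith
  then show ?thesis
  proof cases
    case 1 then show ?thesis using cosine_measure_plane_line_le D by blast
  next
    case 2
    have "cosine_measure (D2 \<union> D1) \<le> 1 / sqrt 5"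
      using cosine_measure_plane_line_le[OF D(9) 2(1) D(8) 2(2)] D(7) by blast
    then show ?thesis using D(1) by (simp add: Un_commute)
  qed
qed

section \<open>The lower bound\<close>

lemma le_cosine_measure:
  fixes S :: "'a::euclidean_space set"
  assumes S: "finite S" "\<And>d. d \<in> S \<Longrightarrow> norm d = 1"
    and r: "\<And>u. norm u = 1 \<Longrightarrow> \<exists>d\<in>S. r \<le> u \<bullet> d"
  shows "r \<le> cosine_measure S"
proof -
  obtain e :: 'a where "norm e = 1" using vector_choose_size[of 1] by auto
  then have ne: "S \<noteq> {}" using r by blast
  obtain u where u: "norm u = 1" "cosine_measure S = Max ((\<lambda>d. (u \<bullet> d) / norm d) ` S)"
    using cosine_measure_attained[OF S(1) ne] by auto
  obtain d where d: "d \<in> S" "r \<le> u \<bullet> d" using r[OF u(1)] by blast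
  have "(u \<bullet> d) / norm d \<le> cosine_measure S" unfolding u(2) using S(1) d(1) by (intro Max_ge) auto
  then show ?thesis using d S(2) by fastforce
qed

lemma exists_inner_ge_cosine_measure:
  fixes S :: "'a::euclidean_space set"
  assumes S: "finite S" "S \<noteq> {}" "\<And>d. d \<in> S \<Longrightarrow> norm d = 1"
  shows "\<exists>d\<in>S. cosine_measure S * norm u \<le> u \<bullet> d"
proof (cases "u = 0")
  case True then show ?thesis using S(2) by auto
next
  case False
  define v where "v = (1 / norm u) *\<^sub>R u"
  have v: "norm v = 1" using False by (simp add: v_def)
  have "Max ((\<lambda>d. (v \<bullet> d) / norm d) ` S) \<in> (\<lambda>d. (v \<bullet> d) / norm d) ` S"
    using S by (intro Max_in) auto
  then obtain d where "d \<in> S" "cosine_measure S \<le> (v \<bullet> d) / norm d"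
    using cosine_measure_le[OF S(1,2) v] by auto
  then show ?thesis using S(3) False by (auto simp: v_def field_simps intro!: bexI[of _ d])
qed

definition equilateral :: "(real^2) set" where
  "equilateral = {vector [1, 0], vector [-1/2, sqrt 3 / 2], vector [-1/2, - sqrt 3 / 2]}"

lemma equilateral_distinct:
  "(vector [1, 0] :: real^2) \<noteq> vector [-1/2, sqrt 3 / 2]"
  "(vector [1, 0] :: real^2) \<noteq> vector [-1/2, - sqrt 3 / 2]"
  "(vector [-1/2, sqrt 3 / 2] :: real^2) \<noteq> vector [-1/2, - sqrt 3 / 2]"
  by (auto simp: vec_eq_iff forall_2)

lemma positive_basis_equilateral: "positive_basis UNIV equilateral" "card equilateral = 3"
proof -
  let ?a = "vector [1, 0] :: real^2" and ?b = "vector [-1/2, sqrt 3 / 2] :: real^2"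
    and ?c = "vector [-1/2, - sqrt 3 / 2] :: real^2"
  note ne = equilateral_distinct equilateral_distinct[symmetric]
  show "card equilateral = 3" using ne by (simp add: equilateral_def)
  have unit: "\<forall>d\<in>equilateral. norm d = 1"
    by (auto simp: equilateral_def norm_vec_def L2_set_def sum_2 power_divide)
  have "x \<in> pspan equilateral" for x :: "real^2"
  proof -
    \<comment> \<open>The vectors of the triangle add up to zero, so the expansion with coefficients
      \<open>2/3 (x \<bullet> d)\<close> may be shifted by any constant; \<open>norm x\<close> makes them nonnegative.\<close>
    define k where "k = (\<lambda>d. 2/3 * (x \<bullet> d) + norm x)"
    have "0 \<le> k d" if "d \<in> equilateral" for d
    proof -
      have "\<bar>x \<bullet> d\<bar> \<le> norm x" using Cauchy_Schwarz_ineq2[of x d] unit that by simp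
      then show ?thesis by (simp add: k_def)
    qed
    moreover have "x = (\<Sum>d\<in>equilateral. k d *\<^sub>R d)"
    proof -
      have "(\<Sum>d\<in>equilateral. k d *\<^sub>R d) = k ?a *\<^sub>R ?a + k ?b *\<^sub>R ?b + k ?c *\<^sub>R ?c"
        using ne by (simp add: equilateral_def add.assoc)
      also have "\<dots> = x"
        by (simp add: vec_eq_iff forall_2 k_def inner_vec_def sum_2 algebra_simps)
      finally show ?thesis by simp
    qed
    ultimately show ?thesis by (rule pspanI)
  qed
  then have pspan: "pspan equilateral = UNIV" by blast
  \<comment> \<open>For each vector, one coordinate separates it from the other two: it has a nonzero entry
    there, and neither of the others has an entry of the same sign.\<close>
  have "?a \<notin> pspan {?b, ?c}"
  proof
    assume "?a \<in> pspan {?b, ?c}"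
    then obtain \<beta> \<gamma> where k: "0 \<le> \<beta>" "0 \<le> \<gamma>" "?a = \<beta> *\<^sub>R ?b + \<gamma> *\<^sub>R ?c"
      by (rule pspan_doubletonE) (rule ne)
    have "?a $ 1 = (\<beta> *\<^sub>R ?b + \<gamma> *\<^sub>R ?c) $ 1" using k(3) by (rule arg_cong)
    then show False using k(1,2) by simp
  qed
  moreover have "?b \<notin> pspan {?a, ?c}"
  proof
    assume "?b \<in> pspan {?a, ?c}"
    then obtain \<beta> \<gamma> where k: "0 \<le> \<beta>" "0 \<le> \<gamma>" "?b = \<beta> *\<^sub>R ?a + \<gamma> *\<^sub>R ?c"
      by (rule pspan_doubletonE) (rule ne)
    have "?b $ 2 = (\<beta> *\<^sub>R ?a + \<gamma> *\<^sub>R ?c) $ 2" using k(3) by (rule arg_cong)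
    then have "sqrt 3 = - (\<gamma> * sqrt 3)" by simp
    moreover have "0 \<le> \<gamma> * sqrt 3" "0 < sqrt 3" using k by simp_all
    ultimately show False by linarith
  qed
  moreover have "?c \<notin> pspan {?a, ?b}"
  proof
    assume "?c \<in> pspan {?a, ?b}"
    then obtain \<beta> \<gamma> where k: "0 \<le> \<beta>" "0 \<le> \<gamma>" "?c = \<beta> *\<^sub>R ?a + \<gamma> *\<^sub>R ?b"
      by (rule pspan_doubletonE) (rule ne)
    have "?c $ 2 = (\<beta> *\<^sub>R ?a + \<gamma> *\<^sub>R ?b) $ 2" using k(3) by (rule arg_cong)
    then have "- sqrt 3 = (\<gamma> * sqrt 3)" by simp
    moreover have "0 \<le> \<gamma> * sqrt 3" "0 < sqrt 3" using k by simp_all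
    ultimately show False by linarith
  qed
  moreover have "equilateral - {?a} = {?b, ?c}" "equilateral - {?b} = {?a, ?c}"
      "equilateral - {?c} = {?a, ?b}"
    using ne by (auto simp: equilateral_def)
  ultimately have "positively_independent equilateral"
    by (simp add: positively_independent_def equilateral_def)
  then show "positive_basis UNIV equilateral"
    using pspan unit by (simp add: positive_basis_def equilateral_def)
qed

text \<open>For a unit vector \<open>u\<close> let \<open>p, q, s\<close> be its inner products with the three vectors. They
  add up to 0 and their squares to 3/2, so the pairwise products of
  \<open>1/2 - p\<close>, \<open>1/2 - q\<close>, \<open>1/2 - s\<close> add up to 0; hence these three numbers cannot all be
  positive.\<close>

lemma cosine_measure_equilateral_ge: "1/2 \<le> cosine_measure equilateral"
proof (rule le_cosine_measure)
  show "finite equilateral" "\<And>d. d \<in> equilateral \<Longrightarrow> norm d = 1"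
    using positive_basis_equilateral by (auto simp: positive_basis_def)
  fix u :: "real^2" assume u: "norm u = 1"
  let ?x = "u $ 1" and ?y = "u $ 2"
  have xy: "?x\<^sup>2 + ?y\<^sup>2 = 1"
    using u by (simp add: norm_eq_1 inner_vec_def sum_2 power2_eq_square)
  define p q s where "p = ?x" and "q = - ?x / 2 + ?y * sqrt 3 / 2" and "s = - ?x / 2 - ?y * sqrt 3 / 2"
  have sqrt3: "sqrt 3 * (sqrt 3 * z) = 3 * z" for z by (simp flip: mult.assoc)
  have "(1/2 - p) * (1/2 - q) + (1/2 - q) * (1/2 - s) + (1/2 - s) * (1/2 - p)
      = 3/4 - 3/4 * (?x\<^sup>2 + ?y\<^sup>2)"
    by (simp add: p_def q_def s_def power2_eq_square field_simps sqrt3)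
  then have eq: "(1/2 - p) * (1/2 - q) + (1/2 - q) * (1/2 - s) + (1/2 - s) * (1/2 - p) = 0"
    using xy by simp
  have "\<not> (0 < 1/2 - p \<and> 0 < 1/2 - q \<and> 0 < 1/2 - s)"
  proof
    assume "0 < 1/2 - p \<and> 0 < 1/2 - q \<and> 0 < 1/2 - s"
    then have "0 < (1/2 - p) * (1/2 - q) + (1/2 - q) * (1/2 - s) + (1/2 - s) * (1/2 - p)"
      by (intro add_pos_pos mult_pos_pos) auto
    then show False using eq by simp
  qed
  then have "1/2 \<le> p \<or> 1/2 \<le> q \<or> 1/2 \<le> s" by linarith
  then show "\<exists>d\<in>equilateral. 1/2 \<le> u \<bullet> d"
    by (simp add: equilateral_def inner_vec_def sum_2 p_def q_def s_def)
qed

lemma cosine_measure_optimal_plane_ge: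
  assumes "optimal_minimal_positive_basis_R2 D"
  shows "1/2 \<le> cosine_measure D"
proof -
  have "cosine_measure equilateral \<le> cosine_measure D"
    using assms positive_basis_equilateral
    by (auto simp: optimal_minimal_positive_basis_R2_def optimal_over_def)
  then show ?thesis using cosine_measure_equilateral_ge by linarith
qed

section \<open>The block diagonal basis\<close>

lemma minimal_positive_basis_R1: "minimal_positive_basis UNIV {vector [1], vector [-1] :: real^1}"
proof -
  let ?e = "vector [1] :: real^1" and ?f = "vector [-1] :: real^1"
  have ne: "?e \<noteq> ?f" by (simp add: vec_eq_iff)
  have "x \<in> pspan {?e, ?f}" for x :: "real^1"
  proof (rule pspanI)
    let ?k = "\<lambda>d::real^1. if d = ?e then max (x $ 1) 0 else max (- x $ 1) 0"
    show "x = (\<Sum>d\<in>{?e, ?f}. ?k d *\<^sub>R d)" using ne by (simp add: vec_eq_iff)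
  qed auto
  moreover have "?e \<notin> pspan {?f}" "?f \<notin> pspan {?e}"
  proof -
    have "pspan {d} = {k *\<^sub>R d | k. 0 \<le> k}" for d :: "real^1"
      by (auto simp: pspan_def)
    then show "?e \<notin> pspan {?f}" "?f \<notin> pspan {?e}" by (auto simp: vec_eq_iff)
  qed
  moreover have "{?e, ?f} - {?e} = {?f}" "{?e, ?f} - {?f} = {?e}" using ne by auto
  moreover have "norm ?e = 1" "norm ?f = 1" by (simp_all add: norm_vec_def)
  ultimately show ?thesis
    using ne by (auto simp: minimal_positive_basis_def positive_basis_def positively_independent_def)
qed

lemma Diag_in_Omega:
  assumes A: "minimal_positive_basis UNIV A" and B: "minimal_positive_basis UNIV B"
  shows "Diag A B \<in> Omega"
proof -
  define f :: "real^2 \<Rightarrow> real^3" where "f = (\<lambda>a. vector [a $ 1, a $ 2, 0])"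
  define g :: "real^1 \<Rightarrow> real^3" where "g = (\<lambda>b. vector [0, 0, b $ 1])"
  have f: "linear f" "\<And>x. norm (f x) = norm x"
    by (auto simp: f_def linear_iff vec_eq_iff forall_3 norm_vec_def L2_set_def sum_2 sum_3)
  have g: "linear g" "\<And>x. norm (g x) = norm x"
    by (auto simp: g_def linear_iff vec_eq_iff forall_3 norm_vec_def L2_set_def sum_3)
  have min: "minimal_positive_basis (range f) (f ` A)" "minimal_positive_basis (range g) (g ` B)"
    using minimal_positive_basis_isometric_image f g A B by blast+
  have inj: "inj f" "inj g"
    using f g by (metis linear_injective_0 norm_eq_zero)+
  have dim: "dim (range f) = 2" "dim (range g) = 1"
    using dim_image_eq[OF f(1), of UNIV] dim_image_eq[OF g(1), of UNIV] inj by simp_all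
  have sub: "subspace (range f)" "subspace (range g)"
    using f(1) g(1) by (simp_all add: linear_subspace_image)
  have int: "range f \<inter> range g = {0}"
  proof -
    have "x = 0" if "x \<in> range f" "x \<in> range g" for x
      using that by (auto simp: f_def g_def vec_eq_iff forall_3)
    then show ?thesis using sub by (auto simp: subspace_0)
  qed
  have "z \<in> {x + y | x y. x \<in> range f \<and> y \<in> range g}" for z
  proof -
    have "z = f (vector [z $ 1, z $ 2]) + g (vector [z $ 3])"
      by (simp add: f_def g_def vec_eq_iff forall_3)
    then show ?thesis by blast
  qed
  then have sum: "{x + y | x y. x \<in> range f \<and> y \<in> range g} = UNIV" by blast
  have pb: "positive_basis (range f) (f ` A)" "positive_basis (range g) (g ` B)"
    using min by (auto simp: minimal_positive_basis_def)
  note un = positive_basis_Un[OF sub int sum pb]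
  have "card (f ` A \<union> g ` B) = 5"
    using min dim un(1) pb by (simp add: card_Un_disjoint minimal_positive_basis_def positive_basis_def)
  moreover have "dim (range f) \<ge> 1" "dim (range g) \<ge> 1" using dim by simp_all
  ultimately have "f ` A \<union> g ` B \<in> Omega"
    unfolding Omega_def mem_Collect_eq
    by (intro conjI un(2) exI[of _ "f ` A"] exI[of _ "g ` B"] exI[of _ "range f"]
        exI[of _ "range g"] refl un(1) sub sum int min)
  moreover have "Diag A B = f ` A \<union> g ` B" by (simp add: Diag_def f_def g_def)
  ultimately show ?thesis by simp
qed

text \<open>If the height \<open>t\<close> of a unit vector satisfies \<open>\<bar>t\<bar> < 1 / \<surd>5\<close>, then its plane part has norm at
  least \<open>2 / \<surd>5\<close>, and half of that is again \<open>1 / \<surd>5\<close>.\<close>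

lemma cosine_measure_Diag_ge:
  assumes A: "positive_basis UNIV A" and half: "1/2 \<le> cosine_measure A"
  shows "1 / sqrt 5 \<le> cosine_measure (Diag A {vector [1], vector [-1]})"
    (is "_ \<le> cosine_measure ?D")
proof (rule le_cosine_measure)
  have A': "finite A" "\<And>d. d \<in> A \<Longrightarrow> norm d = 1" "pspan A = UNIV"
    using A by (auto simp: positive_basis_def)
  have "A \<noteq> {}"
  proof
    assume "A = {}"
    then have "UNIV = {0 :: real^2}" using A'(3) by (simp add: pspan_def)
    then have "vector [1, 0] = (0 :: real^2)" by blast
    then show False by (simp add: vec_eq_iff forall_2)
  qed
  show "finite ?D" using A' by (simp add: Diag_def)
  show "norm d = 1" if "d \<in> ?D" for d
    using that A'(2) by (auto simp: Diag_def norm_vec_def L2_set_def sum_2 sum_3)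
  fix u :: "real^3" assume "norm u = 1"
  define r where "r = 1 / sqrt 5"
  have r: "0 < r" "r\<^sup>2 = 1 / 5" by (auto simp: r_def power_divide)
  have u: "(u $ 1)\<^sup>2 + (u $ 2)\<^sup>2 + (u $ 3)\<^sup>2 = 1"
    using \<open>norm u = 1\<close> by (simp add: norm_eq_1 inner_vec_def sum_3 power2_eq_square)
  consider "r \<le> u $ 3" | "r \<le> - u $ 3" | "\<bar>u $ 3\<bar> < r" by linarith
  then have "\<exists>d\<in>?D. r \<le> u \<bullet> d"
  proof cases
    case 1
    then show ?thesis by (auto simp: Diag_def inner_vec_def sum_3)
  next
    case 2
    then show ?thesis by (auto simp: Diag_def inner_vec_def sum_3)
  next
    case 3
    define p :: "real^2" where "p = vector [u $ 1, u $ 2]"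
    have "(u $ 3)\<^sup>2 \<le> r\<^sup>2" using 3 r by (simp add: abs_le_square_iff[symmetric])
    then have "(2 * r)\<^sup>2 \<le> (norm p)\<^sup>2"
      using u r by (simp add: p_def power2_norm_eq_inner inner_vec_def sum_2 power_mult_distrib
          flip: power2_eq_square)
    then have p: "2 * r \<le> norm p" using power2_le_imp_le norm_ge_zero by blast
    obtain d where d: "d \<in> A" "cosine_measure A * norm p \<le> p \<bullet> d"
      using exists_inner_ge_cosine_measure[OF A'(1) \<open>A \<noteq> {}\<close> A'(2)] by blast
    have "r \<le> 1/2 * norm p" using p by simp
    also have "\<dots> \<le> cosine_measure A * norm p" using half by (intro mult_right_mono) auto
    also note d(2)
    also have "p \<bullet> d = u \<bullet> vector [d $ 1, d $ 2, 0]"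
      by (simp add: p_def inner_vec_def sum_2 sum_3)
    finally show ?thesis using d(1) by (auto simp: Diag_def)
  qed
  then show "\<exists>d\<in>?D. 1 / sqrt 5 \<le> u \<bullet> d" by (simp add: r_def)
qed

theorem theorem31:
  fixes D2 :: "(real^2) set"
  assumes "optimal_minimal_positive_basis_R2 D2"
  shows "optimal_over 5 Omega (Diag D2 {vector [1], vector [-1]})"
proof -
  have D2: "minimal_positive_basis UNIV D2" "positive_basis UNIV D2"
    using assms by (auto simp: optimal_minimal_positive_basis_R2_def minimal_positive_basis_def)
  have mem: "Diag D2 {vector [1], vector [-1]} \<in> Omega"
    using Diag_in_Omega[OF D2(1) minimal_positive_basis_R1] .
  have "1 / sqrt 5 \<le> cosine_measure (Diag D2 {vector [1], vector [-1]})"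
    using cosine_measure_Diag_ge[OF D2(2) cosine_measure_optimal_plane_ge[OF assms]] .
  then have "cosine_measure D' \<le> cosine_measure (Diag D2 {vector [1], vector [-1]})" if "D' \<in> Omega" for D'
    using cosine_measure_Omega_le[OF that] by linarith
  moreover have "positive_basis UNIV (Diag D2 {vector [1], vector [-1]})"
      "card (Diag D2 {vector [1], vector [-1]}) = 5"
    using mem by (simp_all add: Omega_def)
  ultimately show ?thesis using mem by (auto simp: optimal_over_def)
qed

end
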